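(* Let $R\cong R_1\times\cdots\times R_n$ have finitely many ideals, where each $R_i$ is an Artinian local ring with $|A(R_i)^*|\geq 1$. Then $\mathrm{sdim}_M(\Gamma(R))=|V(\Gamma(R))|-2n+2$.
   Context: Rings are commutative with identity. $A(R_i)$ is the set of ideals of $R_i$ with nonzero annihilator and $A(R_i)^*=A(R_i)\setminus\{0\}$. The co-maximal ideal graph $\Gamma(R)$ has as vertices the proper ideals of $R$ not contained in the Jacobson radical, two distinct vertices $I,J$ adjacent iff $I+J=R$. For a connected graph $G$, a vertex $w$ strongly resolves vertices $u,v$ if there is a shortest $u$–$w$ path containing $v$ or a shortest $v$–$w$ path containing $u$; a strong resolving set is a set $W$ of vertices such that every pair of distinct vertices is strongly resolved by some vertex of $W$; $\mathrm{sdim}_M(G)$ is the minimum cardinality of a strong resolving set. *)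

theory Defs
  imports
    "HOL-Algebra.QuotRing"
    "HOL-Algebra.Chinese_Remainder"
    "Graph_Theory.Pair_Digraph"
    "Graph_Theory.Vertex_Walk"
begin

section \<open>Commutative rings\<close>

locale artinian_cring = cring R for R (structure) +
  assumes descending_chain_condition:
    "\<And>I :: nat \<Rightarrow> 'a set. (\<And>k. ideal (I k) R) \<Longrightarrow> (\<And>k. I (Suc k) \<subseteq> I k)
       \<Longrightarrow> \<exists>N. \<forall>k\<ge>N. I k = I N"

locale local_cring = cring R for R (structure) +
  assumes unique_maximalideal: "\<exists>!M. maximalideal M R"

definition annihilator :: "('a, 'm) ring_scheme \<Rightarrow> 'a set \<Rightarrow> 'a set" where
  "annihilator R I = {r \<in> carrier R. \<forall>x\<in>I. r \<otimes>\<^bsub>R\<^esub> x = \<zero>\<^bsub>R\<^esub>}"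

definition annihilating_ideals :: "('a, 'm) ring_scheme \<Rightarrow> 'a set set" where
  "annihilating_ideals R = {I. ideal I R \<and> annihilator R I \<noteq> {\<zero>\<^bsub>R\<^esub>}}"

definition nonzero_annihilating_ideals :: "('a, 'm) ring_scheme \<Rightarrow> 'a set set" where
  "nonzero_annihilating_ideals R = annihilating_ideals R - {{\<zero>\<^bsub>R\<^esub>}}"

text \<open>
  Intersecting with the carrier only matters for the zero ring, which has no maximal ideals.
\<close>
definition jacobson_radical :: "('a, 'm) ring_scheme \<Rightarrow> 'a set" where
  "jacobson_radical R = carrier R \<inter> \<Inter>{M. maximalideal M R}"

section \<open>The co-maximal ideal graph\<close>

definition comaximal_vertices :: "('a, 'm) ring_scheme \<Rightarrow> 'a set set" where
  "comaximal_vertices R =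
     {I. ideal I R \<and> I \<noteq> carrier R \<and> \<not> I \<subseteq> jacobson_radical R}"

text \<open>
  The simple graph is encoded by its symmetric, irreflexive set of arcs: every edge contributes
  its two orientations.
\<close>
definition comaximal_ideal_graph :: "('a, 'm) ring_scheme \<Rightarrow> 'a set pair_pre_digraph" where
  "comaximal_ideal_graph R =
     \<lparr> pverts = comaximal_vertices R,
       parcs = {(I, J). I \<in> comaximal_vertices R \<and> J \<in> comaximal_vertices R \<and> I \<noteq> J \<and>
                        I <+>\<^bsub>R\<^esub> J = carrier R} \<rparr>"

section \<open>Strong metric dimension\<close>

definition shortest_vpath :: "'a pair_pre_digraph \<Rightarrow> 'a \<Rightarrow> 'a vwalk \<Rightarrow> 'a \<Rightarrow> bool" where
  "shortest_vpath G u p v \<longleftrightarrow>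
     vpath p (with_proj G) \<and> hd p = u \<and> last p = v \<and>
     (\<forall>q. vpath q (with_proj G) \<and> hd q = u \<and> last q = v \<longrightarrow> vwalk_length p \<le> vwalk_length q)"

definition strongly_resolves :: "'a pair_pre_digraph \<Rightarrow> 'a \<Rightarrow> 'a \<Rightarrow> 'a \<Rightarrow> bool" where
  "strongly_resolves G w u v \<longleftrightarrow>
     (\<exists>p. shortest_vpath G u p w \<and> v \<in> set p) \<or> (\<exists>p. shortest_vpath G v p w \<and> u \<in> set p)"

definition strong_resolving_set :: "'a pair_pre_digraph \<Rightarrow> 'a set \<Rightarrow> bool" where
  "strong_resolving_set G W \<longleftrightarrow>
     W \<subseteq> pverts G \<and>
     (\<forall>u\<in>pverts G. \<forall>v\<in>pverts G. u \<noteq> v \<longrightarrow> (\<exists>w\<in>W. strongly_resolves G w u v))"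

text \<open>
  Meaningful for graphs with a finite strong resolving set, in particular for all finite connected
  graphs. The graph without vertices has strong metric dimension 0.
\<close>
definition strong_metric_dim :: "'a pair_pre_digraph \<Rightarrow> nat" where
  "strong_metric_dim G = (LEAST k. \<exists>W. strong_resolving_set G W \<and> finite W \<and> card W = k)"

end

theory Submission
  imports Defs
begin

text \<open>
  Let \<open>N\<^sub>1, \<dots>, N\<^sub>n\<close> be the maximal ideals of \<open>R\<close> and call \<open>{i. I \<subseteq> N\<^sub>i}\<close> the support of the ideal \<open>I\<close>.
  Vertices are the ideals whose support is a nonempty proper subset of \<open>{1, \<dots>, n}\<close>, and two of them
  are adjacent iff their supports are disjoint. As no factor is a field, each such support
  belongs to at least two vertices. Distances are at most 3, and inspecting shortest paths shows that
  distinct vertices \<open>u, v\<close> are strongly resolved by a third vertex iff their supports are disjoint or one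
  strictly contains the other. Hence the complements of the strong resolving sets
  are the vertex sets on which the support is injective with laminar image, and a laminar family of
  nonempty proper subsets of an \<open>n\<close>-set has at most \<open>2n - 2\<close> members, a bound that is attained.
\<close>

no_notation vwalk_join (infixr \<open>\<oplus>\<close> 65)

section \<open>Laminar families\<close>

definition laminar :: "'i set set \<Rightarrow> bool" where
  "laminar F \<longleftrightarrow> (\<forall>A\<in>F. \<forall>B\<in>F. A \<inter> B = {} \<or> A \<subseteq> B \<or> B \<subseteq> A)"

lemma laminarD: "laminar F \<Longrightarrow> A \<in> F \<Longrightarrow> B \<in> F \<Longrightarrow> A \<inter> B = {} \<or> A \<subseteq> B \<or> B \<subseteq> A"
  by (auto simp: laminar_def)

text \<open>
  Deleting a point \<open>x\<close> from all members loses at most two of them: \<open>{x}\<close>, and one of the two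
  members \<open>A\<close>, \<open>A \<union> {x}\<close>, which can both occur for at most one \<open>A\<close>.
\<close>

lemma card_laminar_le:
  assumes "finite X" "X \<noteq> {}" "laminar F" "F \<subseteq> Pow X" "{} \<notin> F"
  shows "card F + 1 \<le> 2 * card X"
  using assms
proof (induction X arbitrary: F rule: finite_ne_induct)
  case (singleton x)
  then have "F \<subseteq> {{x}}"
    by (auto simp: subset_singleton_iff)
  then have "card F \<le> card {{x}}"
    by (intro card_mono) auto
  then show ?case
    by simp
next
  case (insert x X)
  define D where "D = {A \<in> F. x \<in> A \<and> A - {x} \<in> F}"
  \<comment> \<open>Dropping \<open>D\<close> makes deletion of \<open>x\<close> injective on
    \<open>E\<close>, and dropping \<open>{x}\<close> keeps the empty set out of the image.\<close>
  define E where "E = F - D - {{x}}"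
  have finF: "finite F"
    using insert by (meson finite_Pow_iff finite_insert finite_subset)
  have "card D \<le> 1"
  proof -
    have le: "A \<subseteq> B" if "A \<in> D" "B \<in> D" for A B
    proof (rule ccontr)
      assume not_le: "\<not> A \<subseteq> B"
      have A: "A \<in> F" "x \<in> A" "A - {x} \<in> F" and B: "B \<in> F" "x \<in> B" "B - {x} \<in> F"
        using that by (auto simp: D_def)
      have "B - {x} \<noteq> {}"
        using B insert.prems(3) by metis
      moreover have "B \<subseteq> A"
        using laminarD[OF insert.prems(1) A(1) B(1)] A(2) B(2) not_le by blast
      \<comment> \<open>\<open>B\<close> and \<open>A - {x}\<close> violate laminarity: they share
        the points of \<open>B - {x}\<close>, only \<open>B\<close> contains \<open>x\<close>, and
        \<open>A - {x} \<subseteq> B\<close> would give \<open>A \<subseteq> B\<close>.\<close>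
      ultimately show False
        using laminarD[OF insert.prems(1) B(1) A(3)] A B not_le by blast
    qed
    have uniq: "A = B" if "A \<in> D" "B \<in> D" for A B
      using le[of A B] le[of B A] that by simp
    have "finite D"
      using finF by (simp add: D_def)
    then show ?thesis
      using uniq by (simp add: card_le_Suc0_iff_eq)
  qed
  moreover have "card F \<le> card E + card (D \<union> {{x}})"
  proof -
    have "F \<subseteq> E \<union> (D \<union> {{x}})"
      by (auto simp: E_def)
    moreover have "finite (E \<union> (D \<union> {{x}}))"
      using finF by (auto simp: E_def D_def)
    ultimately have "card F \<le> card (E \<union> (D \<union> {{x}}))"
      by (rule card_mono[rotated])
    also have "\<dots> \<le> card E + card (D \<union> {{x}})"
      by (rule card_Un_le)
    finally show ?thesis .
  qed
  moreover have "card (D \<union> {{x}}) \<le> card D + 1"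
    using card_Un_le[of D "{{x}}"] by simp
  moreover have "card E + 1 \<le> 2 * card X"
  proof -
    let ?r = "\<lambda>A. A - {x}"
    have inj: "inj_on ?r E"
    proof (rule inj_onI)
      fix A B assume AB: "A \<in> E" "B \<in> E" "A - {x} = B - {x}"
      have *: "x \<in> Q" if "P \<in> E" "Q \<in> E" "P - {x} = Q - {x}" "x \<in> P" for P Q
      proof (rule ccontr)
        assume "x \<notin> Q"
        then have "P - {x} = Q"
          using that by simp
        then show False
          using that by (auto simp: E_def D_def)
      qed
      then have "x \<in> A \<longleftrightarrow> x \<in> B"
        using AB by metis
      then show "A = B"
        using AB(3) by (metis Diff_insert0 Diff_empty insert_Diff)
    qed
    have "laminar (?r ` E)"
      unfolding laminar_def
    proof (intro ballI; elim imageE)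
      fix A' B' A B assume "A \<in> E" "B \<in> E" and [simp]: "A' = A - {x}" "B' = B - {x}"
      then have "A \<inter> B = {} \<or> A \<subseteq> B \<or> B \<subseteq> A"
        by (intro laminarD[OF insert.prems(1)]) (auto simp: E_def)
      then show "A' \<inter> B' = {} \<or> A' \<subseteq> B' \<or> B' \<subseteq> A'"
        by auto
    qed
    moreover have "?r ` E \<subseteq> Pow X"
      using insert.prems(2) by (auto simp: E_def)
    moreover have "{} \<notin> ?r ` E"
      using insert.prems(3) by (auto simp: E_def subset_singleton_iff)
    ultimately have "card (?r ` E) + 1 \<le> 2 * card X"
      by (rule insert.IH)
    then show ?thesis
      using inj by (simp add: card_image)
  qed
  ultimately show ?case
    using insert.hyps by simp
qed

text \<open>Adding \<open>X\<close>, which contains every member, keeps the family laminar; as it is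
  a new member, the bound improves by one.\<close>

lemma card_laminar_proper_le:
  assumes "finite X" "X \<noteq> {}" "laminar F" "F \<subseteq> Pow X" "{} \<notin> F" "X \<notin> F"
  shows "card F + 2 \<le> 2 * card X"
proof -
  have "laminar (insert X F)"
    using assms(3,4) by (auto simp: laminar_def)
  then have "card (insert X F) + 1 \<le> 2 * card X"
    using assms by (intro card_laminar_le) auto
  moreover have "finite F"
    using assms by (meson finite_Pow_iff finite_subset)
  ultimately show ?thesis
    using assms by simp
qed

text \<open>An increasing chain of sets that grows by one point at a time up to \<open>X\<close>,
  together with all singletons, attains the bound. The induction adds \<open>{x}\<close> and the
  enlarged ground set; \<open>X \<in> F\<close> is recorded so that the top can be removed
  afterwards.\<close>

lemma laminar_exists:
  assumes "finite X" "X \<noteq> {}"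
  shows "\<exists>F. laminar F \<and> F \<subseteq> Pow X \<and> {} \<notin> F \<and> X \<in> F \<and> card F + 1 = 2 * card X"
  using assms
proof (induction X rule: finite_ne_induct)
  case (singleton x)
  show ?case
    by (rule exI[of _ "{{x}}"]) (auto simp: laminar_def)
next
  case (insert x X)
  then obtain F where F: "laminar F" "F \<subseteq> Pow X" "{} \<notin> F" "X \<in> F" "card F + 1 = 2 * card X"
    by blast
  have "finite F"
    using F(2) insert.hyps(1) by (meson finite_Pow_iff finite_subset)
  moreover have "{x} \<notin> F" "insert x X \<notin> F" "{x} \<noteq> insert x X"
    using F(2) insert.hyps by auto
  ultimately have "card (insert {x} (insert (insert x X) F)) = card F + 2"
    by simp
  moreover have "laminar (insert {x} (insert (insert x X) F))"
    using F(1,2) insert.hyps(3) unfolding laminar_def by blast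
  ultimately show ?case
    using F insert.hyps by (intro exI[of _ "insert {x} (insert (insert x X) F)"]) auto
qed

lemma laminar_proper_exists:
  assumes "finite X" "X \<noteq> {}"
  obtains F where "laminar F" "F \<subseteq> Pow X" "{} \<notin> F" "X \<notin> F" "card F + 2 = 2 * card X"
proof -
  obtain F where F: "laminar F" "F \<subseteq> Pow X" "{} \<notin> F" "X \<in> F" "card F + 1 = 2 * card X"
    using laminar_exists[OF assms] by blast
  have "finite F"
    using F(2) assms(1) by (meson finite_Pow_iff finite_subset)
  then have "card (F - {X}) + 1 = card F"
    using F(4) by (metis Suc_eq_plus1 card_Suc_Diff1)
  moreover have "laminar (F - {X})"
    using F(1) by (auto simp: laminar_def)
  ultimately show thesis
    using that[of "F - {X}"] F by auto
qed

section \<open>Graphs of disjoint supports\<close>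

text \<open>Keeps only what the supports reveal about the ideals: \<open>X\<close> stands for the
  set of maximal ideals and \<open>supp v\<close> for those containing \<open>v\<close>. By
  \<open>two_vertices\<close>, every admissible support still occurs outside any set on which
  \<open>supp\<close> is injective.\<close>

locale support_graph =
  fixes V :: "'v set" and X :: "'i set" and supp :: "'v \<Rightarrow> 'i set"
  assumes finite_V: "finite V"
    and supp_subset: "v \<in> V \<Longrightarrow> supp v \<subseteq> X"
    and supp_nonempty: "v \<in> V \<Longrightarrow> supp v \<noteq> {}"
    and supp_proper: "v \<in> V \<Longrightarrow> supp v \<noteq> X"
    and two_vertices: "S \<subseteq> X \<Longrightarrow> S \<noteq> {} \<Longrightarrow> S \<noteq> X \<Longrightarrow>
      \<exists>u\<in>V. \<exists>v\<in>V. u \<noteq> v \<and> supp u = S \<and> supp v = S"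
begin

text \<open>Supports of vertices are nonempty, so disjointness already excludes loops.\<close>

definition graph :: "'v pair_pre_digraph" where
  "graph = \<lparr> pverts = V, parcs = {(u, v). u \<in> V \<and> v \<in> V \<and> supp u \<inter> supp v = {}} \<rparr>"

lemma graph_simps [simp]:
  "pverts graph = V"
  "(u, v) \<in> parcs graph \<longleftrightarrow> u \<in> V \<and> v \<in> V \<and> supp u \<inter> supp v = {}"
  by (auto simp: graph_def)

section \<open>Short paths\<close>

lemma vpath_singleton [simp]: "vpath [u] (with_proj graph) \<longleftrightarrow> u \<in> V"
  by (auto simp: vpath_def vwalk_def)

lemma vpath_Cons [simp]:
  "vpath (u # v # p) (with_proj graph) \<longleftrightarrow>
     u \<in> V \<and> supp u \<inter> supp v = {} \<and> u \<notin> set (v # p) \<and> vpath (v # p) (with_proj graph)"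
  by (auto simp: vpath_def vwalk_def)

lemma vpath_neq_Nil: "vpath p (with_proj graph) \<Longrightarrow> p \<noteq> []"
  by (auto simp: vpath_def vwalk_def)

text \<open>Serves for lower bounds on distances: the paths with at most three vertices are spelled
  out, and all longer ones share the last case.\<close>

lemma vpath_cases:
  assumes "vpath p (with_proj graph)" "hd p = u" "last p = w"
  obtains (1) "p = [u]" "u = w"
  | (2) "p = [u, w]" "supp u \<inter> supp w = {}"
  | (3) x where "p = [u, x, w]" "supp u \<inter> supp x = {}" "supp x \<inter> supp w = {}" "x \<in> V"
  | (4) "length p \<ge> 4"
proof -
  consider (a) a where "p = [a]" | (b) a b where "p = [a, b]" | (c) a b c where "p = [a, b, c]"
    | (d) a b c d q where "p = a # b # c # d # q"
    using vpath_neq_Nil[OF assms(1)] by (metis list.exhaust)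
  then show thesis
    by cases (use assms that in auto)
qed

lemma vertex_exists:
  assumes "S \<subseteq> X" "S \<noteq> {}" "S \<noteq> X"
  obtains u where "u \<in> V" "supp u = S"
  using two_vertices[OF assms] by blast

lemma complement_exists:
  assumes "u \<in> V"
  obtains x where "x \<in> V" "supp x = X - supp u"
  using vertex_exists[of "X - supp u"] supp_subset[OF assms] supp_nonempty[OF assms]
    supp_proper[OF assms] by auto

lemma supp_disjoint_neq: "u \<in> V \<Longrightarrow> supp u \<inter> supp v = {} \<Longrightarrow> u \<noteq> v"
  using supp_nonempty by blast

text \<open>\<open>length\<close> counts vertices, so distances are at most 3. If the supports do
  not cover \<open>X\<close>, a vertex supported on the complement of their union is a common
  neighbour; if they do, the complements of the two supports are disjoint and give the two inner
  vertices.\<close>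

lemma vpath_length_le_4:
  assumes "u \<in> V" "w \<in> V"
  obtains p where "vpath p (with_proj graph)" "hd p = u" "last p = w" "length p \<le> 4"
    "supp u \<union> supp w \<noteq> X \<Longrightarrow> length p \<le> 3"
proof -
  consider "u = w" | "u \<noteq> w" "supp u \<inter> supp w = {}" 
    | "u \<noteq> w" "supp u \<inter> supp w \<noteq> {}" "supp u \<union> supp w \<noteq> X"
    | "u \<noteq> w" "supp u \<inter> supp w \<noteq> {}" "supp u \<union> supp w = X"
    by blast
  then show thesis
  proof cases
    case 1
    then show thesis using that[of "[u]"] assms by simp
  next
    case 2
    then show thesis using that[of "[u, w]"] assms by simp
  next
    case 3
    then obtain x where x: "x \<in> V" "supp x = X - (supp u \<union> supp w)"
      using vertex_exists[of "X - (supp u \<union> supp w)"] supp_subset[OF assms(1)] supp_subset[OF assms(2)]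
        supp_nonempty[OF assms(1)] by auto
    then have "supp u \<inter> supp x = {}" "supp x \<inter> supp w = {}"
      by auto
    then show thesis using that[of "[u, x, w]"] 3 x assms supp_disjoint_neq by auto
  next
    case 4
    obtain x where x: "x \<in> V" "supp x = X - supp u"
      using complement_exists assms by blast
    obtain y where y: "y \<in> V" "supp y = X - supp w"
      using complement_exists assms by blast
    have *: "supp u \<inter> supp x = {}" "supp x \<inter> supp y = {}" "supp y \<inter> supp w = {}"
      using x y 4 by auto
    have "u \<noteq> y" "x \<noteq> w"
      using x y 4 assms supp_nonempty by auto
    then show thesis using that[of "[u, x, y, w]"] 4 x y * assms supp_disjoint_neq by auto
  qed
qed

section \<open>Shortest paths and strongly resolved pairs\<close>

lemma shortest_vpath_exists:
  assumes "u \<in> V" "w \<in> V"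
  obtains p where "shortest_vpath graph u p w"
proof -
  obtain q where "vpath q (with_proj graph) \<and> hd q = u \<and> last q = w"
    using vpath_length_le_4[OF assms] by metis
  from ex_has_least_nat[where P = "\<lambda>q. vpath q (with_proj graph) \<and> hd q = u \<and> last q = w", OF this]
  obtain p where "vpath p (with_proj graph) \<and> hd p = u \<and> last p = w"
    "\<forall>q. vpath q (with_proj graph) \<and> hd q = u \<and> last q = w \<longrightarrow> vwalk_length p \<le> vwalk_length q"
    by blast
  then have "shortest_vpath graph u p w"
    by (simp add: shortest_vpath_def)
  then show thesis
    by (rule that)
qed

text \<open>A path contains its endpoints, so it suffices that a shortest path exists. Hence only
  pairs outside a candidate resolving set need attention.\<close>

lemma strongly_resolves_self:
  assumes "u \<in> V" "v \<in> V"
  shows "strongly_resolves graph u u v" "strongly_resolves graph v u v"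
proof -
  have *: "\<exists>p. shortest_vpath graph a p b \<and> b \<in> set p" if ab: "a \<in> V" "b \<in> V" for a b
  proof -
    obtain p where p: "shortest_vpath graph a p b"
      by (rule shortest_vpath_exists[OF ab])
    then have "p \<noteq> []" "last p = b"
      by (auto simp: shortest_vpath_def dest: vpath_neq_Nil)
    then show ?thesis
      using p last_in_set by blast
  qed
  show "strongly_resolves graph u u v" "strongly_resolves graph v u v"
    using *[OF assms] *[OF assms(2,1)] by (auto simp: strongly_resolves_def)
qed

lemma strongly_resolves_commute: "strongly_resolves G w u v \<longleftrightarrow> strongly_resolves G w v u"
  by (auto simp: strongly_resolves_def)

text \<open>\<open>u\<close> and \<open>w\<close> share a nonempty support, so they are not adjacent
  and the path \<open>u, v, w\<close> is shortest.\<close>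

lemma strongly_resolves_disjoint:
  assumes "u \<in> V" "v \<in> V" "supp u \<inter> supp v = {}" "w \<in> V" "w \<noteq> u" "supp w = supp u"
  shows "strongly_resolves graph w u v"
proof -
  have "shortest_vpath graph u [u, v, w] w"
    unfolding shortest_vpath_def
  proof (intro conjI allI impI)
    show "vpath [u, v, w] (with_proj graph)"
      using assms supp_disjoint_neq[of u v] supp_disjoint_neq[of v w] by auto
    fix q assume "vpath q (with_proj graph) \<and> hd q = u \<and> last q = w"
    then have "vpath q (with_proj graph)" "hd q = u" "last q = w"
      by auto
    then show "vwalk_length [u, v, w] \<le> vwalk_length q"
      by (cases rule: vpath_cases) (use assms supp_nonempty in auto)
  qed auto
  then show ?thesis
    unfolding strongly_resolves_def by (metis list.set_intros)
qed

text \<open>The supports of \<open>u\<close> and \<open>w\<close> overlap and cover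
  \<open>X\<close>, so these vertices are neither adjacent nor joined through a common neighbour.
  The path \<open>u, x, v, w\<close>, with \<open>x\<close> supported on the complement of
  \<open>supp u\<close>, is therefore shortest.\<close>

lemma strongly_resolves_psubset:
  assumes "u \<in> V" "v \<in> V" "supp v \<subset> supp u" "w \<in> V" "supp w = X - supp v"
  shows "strongly_resolves graph w u v"
proof -
  obtain x where x: "x \<in> V" "supp x = X - supp u"
    using complement_exists assms by blast
  note sub = supp_subset[OF assms(1)] supp_subset[OF assms(2)]
  have ne: "supp u \<noteq> supp w" "supp x \<noteq> supp w"
    using assms x sub supp_nonempty[OF assms(2)] by auto
  have "shortest_vpath graph u [u, x, v, w] w"
    unfolding shortest_vpath_def
  proof (intro conjI allI impI)
    show "vpath [u, x, v, w] (with_proj graph)"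
      using assms x ne supp_disjoint_neq[of u x] supp_disjoint_neq[of x v] supp_disjoint_neq[of v w]
      by auto
    fix q assume "vpath q (with_proj graph) \<and> hd q = u \<and> last q = w"
    then have "vpath q (with_proj graph)" "hd q = u" "last q = w"
      by auto
    then show "vwalk_length [u, x, v, w] \<le> vwalk_length q"
    proof (cases rule: vpath_cases)
      case 2
      then show ?thesis
        using assms sub by blast
    next
      case (3 y)
      then have "supp y = {}"
        using assms supp_subset[of y] by blast
      then show ?thesis
        using 3 supp_nonempty by blast
    qed (use ne in auto)
  qed auto
  then show ?thesis
    unfolding strongly_resolves_def by (metis list.set_intros)
qed

lemma strong_resolving_set_Diff:
  assumes "U \<subseteq> V" "inj_on supp U" "laminar (supp ` U)"
  shows "strong_resolving_set graph (V - U)"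
proof -
  \<comment> \<open>Of two vertices with support \<open>S\<close>, injectivity allows at most one in
    \<open>U\<close>.\<close>
  have other: "\<exists>w\<in>V - U. supp w = S" if "S \<subseteq> X" "S \<noteq> {}" "S \<noteq> X" for S
    using two_vertices[OF that] inj_onD[OF assms(2)] by (metis DiffI)
  have sub: "\<exists>w\<in>V - U. strongly_resolves graph w u v"
    if uv: "u \<in> V" "v \<in> V" "supp v \<subset> supp u" for u v
  proof -
    obtain w where "w \<in> V - U" "supp w = X - supp v"
      using other[of "X - supp v"] supp_proper[OF uv(2)] supp_nonempty[OF uv(2)] supp_subset[OF uv(2)]
      by auto
    then show ?thesis
      using strongly_resolves_psubset uv by blast
  qed
  have "\<exists>w\<in>V - U. strongly_resolves graph w u v" if uv: "u \<in> V" "v \<in> V" "u \<noteq> v" for u v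
  proof (cases "u \<in> U \<and> v \<in> U")
    case False
    then show ?thesis
      using strongly_resolves_self uv by blast
  next
    case True
    then have "supp u \<noteq> supp v"
      using inj_onD[OF assms(2)] uv by blast
    with True laminarD[OF assms(3), of "supp u" "supp v"]
    consider "supp u \<inter> supp v = {}" | "supp u \<subset> supp v" | "supp v \<subset> supp u"
      by blast
    then show ?thesis
    proof cases
      case 1
      obtain w where "w \<in> V - U" "supp w = supp u"
        using other[of "supp u"] supp_proper[of u] supp_nonempty[of u] supp_subset[of u] uv by auto
      then show ?thesis
        using strongly_resolves_disjoint 1 uv True by blast
    next
      case 2
      then show ?thesis
        using sub[OF uv(2,1)] by (simp add: strongly_resolves_commute[of _ _ v u])
    next
      case 3
      then show ?thesis
        using sub[OF uv(1,2)] by simp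
    qed
  qed
  then show ?thesis
    by (auto simp: strong_resolving_set_def)
qed

text \<open>An inner vertex of a shortest path either is a neighbour of \<open>u\<close> or is the
  third vertex of a path \<open>u, b, c, w\<close>. In the latter case \<open>u\<close> and
  \<open>w\<close> have distance 3, which confines \<open>supp c\<close> to the part of
  \<open>supp u\<close> outside \<open>supp w\<close>.\<close>

lemma shortest_vpath_through:
  assumes "u \<in> V" "w \<in> V" "shortest_vpath graph u p w" "v \<in> set p" "v \<noteq> u" "v \<noteq> w"
  shows "supp u \<inter> supp v = {} \<or> supp v \<subset> supp u"
proof -
  have p: "vpath p (with_proj graph)" "hd p = u" "last p = w"
    using assms by (auto simp: shortest_vpath_def)
  obtain q where q: "vpath q (with_proj graph)" "hd q = u" "last q = w" "length q \<le> 4"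
    "supp u \<union> supp w \<noteq> X \<Longrightarrow> length q \<le> 3"
    using vpath_length_le_4 assms by metis
  have le: "vwalk_length p \<le> vwalk_length q"
    using assms q by (auto simp: shortest_vpath_def)
  from p show ?thesis
  proof (cases rule: vpath_cases)
    case 4
    moreover have "length p \<le> 4"
      using le q(4) by simp
    ultimately have "length p = 4"
      by simp
    then obtain a b c d where "p = [a, b, c, d]"
      by (auto simp: length_Suc_conv numeral_eq_Suc)
    with p have pp: "p = [u, b, c, w]" "supp u \<inter> supp b = {}" "supp c \<inter> supp w = {}" "c \<in> V"
      by auto
    show ?thesis
    proof (cases "v = b")
      case True
      then show ?thesis using pp by simp
    next
      case False
      then have v: "v = c"
        using pp assms by auto
      \<comment> \<open>Otherwise \<open>q\<close> would have at most three vertices and be shorter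
        than \<open>p\<close>.\<close>
      have "supp u \<union> supp w = X"
        using q(5) le pp by fastforce
      moreover have "supp u \<inter> supp w \<noteq> {}"
      proof
        assume "supp u \<inter> supp w = {}"
        then have "vpath [u, w] (with_proj graph)"
          using assms supp_disjoint_neq by auto
        then have "vwalk_length p \<le> vwalk_length [u, w]"
          using assms(3) by (simp add: shortest_vpath_def del: vwalk_length_simp)
        then show False
          using pp by simp
      qed
      ultimately show ?thesis
        using pp v supp_subset[of c] by blast
    qed
  qed (use assms in auto)
qed

text \<open>A vertex of \<open>W\<close> resolving two vertices outside \<open>W\<close> differs
  from both, so one of them is an inner vertex of a shortest path starting at the other. The
  resulting alternatives exclude equal supports, which gives injectivity.\<close>

lemma strong_resolving_set_laminar:
  assumes "strong_resolving_set graph W"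
  shows "inj_on supp (V - W)" "laminar (supp ` (V - W))"
proof -
  have *: "supp u \<inter> supp v = {} \<or> supp v \<subset> supp u \<or> supp u \<subset> supp v"
    if uv: "u \<in> V - W" "v \<in> V - W" "u \<noteq> v" for u v
  proof -
    obtain w where w: "w \<in> W" "strongly_resolves graph w u v"
      using assms uv unfolding strong_resolving_set_def graph_simps by (metis DiffD1)
    then have "w \<in> V" "w \<noteq> u" "w \<noteq> v"
      using assms uv by (auto simp: strong_resolving_set_def)
    then show ?thesis
      using w uv shortest_vpath_through[of u w _ v] shortest_vpath_through[of v w _ u]
      unfolding strongly_resolves_def by blast
  qed
  show "inj_on supp (V - W)"
  proof (rule inj_onI)
    fix u v assume "u \<in> V - W" "v \<in> V - W" "supp u = supp v"
    then show "u = v"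
      using *[of u v] supp_nonempty[of u] by auto
  qed
  show "laminar (supp ` (V - W))"
    unfolding laminar_def
  proof (intro ballI; elim imageE)
    fix A B u v assume "u \<in> V - W" "v \<in> V - W" "A = supp u" "B = supp v"
    then show "A \<inter> B = {} \<or> A \<subseteq> B \<or> B \<subseteq> A"
      using *[of u v] by (cases "u = v") auto
  qed
qed

text \<open>Complements of strong resolving sets correspond to laminar families, so the minimum
  comes from a largest family, with \<open>2 * card X - 2\<close> members. The additive form avoids
  truncated subtraction.\<close>

theorem strong_metric_dim_graph:
  assumes "finite X" "X \<noteq> {}"
  shows "strong_metric_dim graph + 2 * card X = card V + 2"
proof -
  obtain F where F: "laminar F" "F \<subseteq> Pow X" "{} \<notin> F" "X \<notin> F" "card F + 2 = 2 * card X"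
    using laminar_proper_exists assms by blast
  have "\<forall>S\<in>F. \<exists>v. v \<in> V \<and> supp v = S"
    using vertex_exists F by (metis PowD subsetD)
  \<comment> \<open>\<open>g\<close> selects one vertex for each member of the extremal family; the
    selected vertices are left out of the resolving set.\<close>
  then obtain g where g: "\<And>S. S \<in> F \<Longrightarrow> g S \<in> V" "\<And>S. S \<in> F \<Longrightarrow> supp (g S) = S"
    by metis
  have U: "g ` F \<subseteq> V"
    using g by blast
  have "inj_on supp (g ` F)"
    using g(2) by (auto intro!: inj_onI)
  moreover have "supp ` g ` F = F"
    using g(2) by (force simp: image_image)
  ultimately have W: "strong_resolving_set graph (V - g ` F)"
    using strong_resolving_set_Diff[OF U] F(1) by simp
  have "card (g ` F) = card F"
    using g(2) by (intro card_image inj_on_inverseI)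
  then have "card (V - g ` F) + card F = card V"
    using U finite_V by (metis card_Diff_subset card_mono finite_subset le_add_diff_inverse2)
  then have card_W: "card (V - g ` F) + 2 * card X = card V + 2"
    using F(5) by simp
  have "strong_metric_dim graph = card (V - g ` F)"
    unfolding strong_metric_dim_def
  proof (rule Least_equality)
    show "\<exists>W. strong_resolving_set graph W \<and> finite W \<and> card W = card (V - g ` F)"
      using W finite_V by blast
  next
    fix k assume "\<exists>W. strong_resolving_set graph W \<and> finite W \<and> card W = k"
    then obtain W where W: "strong_resolving_set graph W" "finite W" "card W = k"
      by blast
    have "card (supp ` (V - W)) + 2 \<le> 2 * card X"
    proof (rule card_laminar_proper_le[OF assms])
      show "laminar (supp ` (V - W))"
        using strong_resolving_set_laminar W by blast
    qed (use supp_subset supp_nonempty supp_proper in blast)+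
    moreover have "card (supp ` (V - W)) = card (V - W)"
      using strong_resolving_set_laminar W card_image by blast
    moreover have "card (V - W) + card W = card V"
      using W finite_V
      by (metis card_Diff_subset card_mono le_add_diff_inverse2 strong_resolving_set_def graph_simps(1))
    ultimately show "card (V - g ` F) \<le> k"
      using card_W W(3) by linarith
  qed
  then show ?thesis
    using card_W by simp
qed

end

section \<open>Ideals in finite products of local rings\<close>

text \<open>With finitely many ideals, a maximal element among the proper ideals above
  \<open>J\<close> exists without Zorn's lemma.\<close>

lemma (in ring) proper_ideal_le_maximalideal:
  assumes "finite {I. ideal I R}" "ideal J R" "J \<noteq> carrier R"
  obtains M where "maximalideal M R" "J \<subseteq> M"
proof -
  let ?P = "{I. ideal I R \<and> I \<noteq> carrier R}"
  have fin: "finite ?P"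
    by (rule finite_subset[OF _ assms(1)]) auto
  have "J \<in> ?P"
    using assms by simp
  from finite_has_maximal2[OF fin this]
  obtain M where M: "M \<in> ?P" "J \<subseteq> M" "\<forall>I\<in>?P. M \<subseteq> I \<longrightarrow> M = I"
    by blast
  have "maximalideal M R"
  proof (rule maximalidealI)
    show "ideal M R" "carrier R \<noteq> M"
      using M(1) by auto
    show "I = M \<or> I = carrier R" if "ideal I R" "M \<subseteq> I" for I
      using M(3) that by blast
  qed
  then show thesis
    using that M(2) by blast
qed

text \<open>Surjectivity turns every scalar of \<open>S\<close> into an image from \<open>R\<close>,
  which yields absorption.\<close>

lemma (in ring_hom_ring) ideal_image:
  assumes "h ` carrier R = carrier S" "ideal I R"
  shows "ideal (h ` I) S"
proof -
  interpret I: ideal I R by fact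
  show ?thesis
  proof (rule idealI[OF S.ring_axioms])
    show "subgroup (h ` I) (add_monoid S)"
    proof (rule group.subgroupI[OF S.a_group])
      show "h ` I \<subseteq> carrier (add_monoid S)"
        using I.a_subset by auto
      show "h ` I \<noteq> {}"
        using I.zero_closed by blast
    next
      fix a assume "a \<in> h ` I"
      then obtain x where x: "x \<in> I" "a = h x" by blast
      then have "inv\<^bsub>add_monoid S\<^esub> a = h (\<ominus> x)"
        using I.Icarr by (simp add: a_inv_def[symmetric])
      then show "inv\<^bsub>add_monoid S\<^esub> a \<in> h ` I"
        using x I.a_inv_closed by blast
    next
      fix a b assume "a \<in> h ` I" "b \<in> h ` I"
      then obtain x y where "x \<in> I" "a = h x" "y \<in> I" "b = h y" by blast
      then have "a \<oplus>\<^bsub>S\<^esub> b = h (x \<oplus> y)" "x \<oplus> y \<in> I"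
        using I.Icarr I.a_closed by auto
      then show "a \<otimes>\<^bsub>add_monoid S\<^esub> b \<in> h ` I"
        by simp
    qed
  next
    fix a x assume "a \<in> h ` I" "x \<in> carrier S"
    then obtain b y where "b \<in> I" "a = h b" "y \<in> carrier R" "x = h y"
      using assms(1) by blast
    then have "x \<otimes>\<^bsub>S\<^esub> a = h (y \<otimes> b)" "a \<otimes>\<^bsub>S\<^esub> x = h (b \<otimes> y)" "y \<otimes> b \<in> I" "b \<otimes> y \<in> I"
      using I.Icarr I.I_l_closed I.I_r_closed by auto
    then show "x \<otimes>\<^bsub>S\<^esub> a \<in> h ` I" "a \<otimes>\<^bsub>S\<^esub> x \<in> h ` I"
      by auto
  qed
qed

text \<open>Taking preimages is injective on the ideals of \<open>S\<close>, since surjectivity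
  recovers each ideal as the image of its preimage.\<close>

lemma (in ring_hom_ring) finite_ideals_image:
  assumes surj: "h ` carrier R = carrier S" and "finite {I. ideal I R}"
  shows "finite {I. ideal I S}"
proof (rule finite_imageD)
  let ?f = "\<lambda>I. {r \<in> carrier R. h r \<in> I}"
  show "finite (?f ` {I. ideal I S})"
    by (rule finite_subset[OF _ assms(2)]) (auto intro: ideal_vimage)
  have inv: "h ` ?f I = I" if "ideal I S" for I
  proof (intro equalityI subsetI)
    fix a assume "a \<in> I"
    then have "a \<in> h ` carrier R"
      unfolding surj by (rule ideal.Icarr[OF that])
    then show "a \<in> h ` ?f I"
      using \<open>a \<in> I\<close> by blast
  qed auto
  show "inj_on ?f {I. ideal I S}"
    by (rule inj_on_inverseI[where g = "image h"]) (rule inv, simp)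
qed

section \<open>Coordinates in the direct product of a list of rings\<close>

lemma RDirProd_list_mult_nth:
  assumes "i < length Rs" "x \<in> carrier (RDirProd_list Rs)" "y \<in> carrier (RDirProd_list Rs)"
  shows "(x \<otimes>\<^bsub>RDirProd_list Rs\<^esub> y) ! i = x ! i \<otimes>\<^bsub>Rs ! i\<^esub> y ! i"
  using assms
proof (induction Rs arbitrary: x y i)
  case (Cons R Rs)
  obtain a as b bs where xy: "x = a # as" "y = b # bs" "a \<in> carrier R" "b \<in> carrier R"
    "as \<in> carrier (RDirProd_list Rs)" "bs \<in> carrier (RDirProd_list Rs)"
    using Cons.prems by (auto simp: RDirProd_list_carrier)
  \<comment> \<open>The list product is built recursively from binary products, and consing is the
    homomorphism from pairs to lists.\<close>
  have "x \<otimes>\<^bsub>RDirProd_list (R # Rs)\<^esub> y = (a \<otimes>\<^bsub>R\<^esub> b) # (as \<otimes>\<^bsub>RDirProd_list Rs\<^esub> bs)"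
    using ring_hom_mult[OF RDirProd_list_hom1[of R Rs], of "(a, as)" "(b, bs)"] xy
    by (simp add: RDirProd_carrier) (simp add: RDirProd_def DirProd_def monoid.defs)
  then show ?case
    using Cons.IH[of "i - 1"] Cons.prems xy by (cases i) auto
qed simp

lemma RDirProd_list_add_nth:
  assumes "i < length Rs" "x \<in> carrier (RDirProd_list Rs)" "y \<in> carrier (RDirProd_list Rs)"
  shows "(x \<oplus>\<^bsub>RDirProd_list Rs\<^esub> y) ! i = x ! i \<oplus>\<^bsub>Rs ! i\<^esub> y ! i"
  using assms
proof (induction Rs arbitrary: x y i)
  case (Cons R Rs)
  obtain a as b bs where xy: "x = a # as" "y = b # bs" "a \<in> carrier R" "b \<in> carrier R"
    "as \<in> carrier (RDirProd_list Rs)" "bs \<in> carrier (RDirProd_list Rs)"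
    using Cons.prems by (auto simp: RDirProd_list_carrier)
  have "x \<oplus>\<^bsub>RDirProd_list (R # Rs)\<^esub> y = (a \<oplus>\<^bsub>R\<^esub> b) # (as \<oplus>\<^bsub>RDirProd_list Rs\<^esub> bs)"
    using ring_hom_add[OF RDirProd_list_hom1[of R Rs], of "(a, as)" "(b, bs)"] xy
    by (simp add: RDirProd_carrier) (simp add: RDirProd_def DirProd_def monoid.defs)
  then show ?case
    using Cons.IH[of "i - 1"] Cons.prems xy by (cases i) auto
qed simp

lemma RDirProd_list_one_nth:
  assumes "i < length Rs"
  shows "\<one>\<^bsub>RDirProd_list Rs\<^esub> ! i = \<one>\<^bsub>Rs ! i\<^esub>"
  using assms unfolding RDirProd_list_one by (induction Rs arbitrary: i) (auto simp: nth_Cons')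

lemma RDirProd_list_nth_hom:
  assumes "i < length Rs"
  shows "(\<lambda>x. x ! i) \<in> ring_hom (RDirProd_list Rs) (Rs ! i)"
  using assms
  by (intro ring_hom_memI)
    (auto simp: RDirProd_list_carrier_mem RDirProd_list_mult_nth RDirProd_list_add_nth
      RDirProd_list_one_nth)

text \<open>
  The maps \<open>p i\<close> are the projections of a product decomposition of \<open>R\<close>, which is expressed by
  joint surjectivity and joint injectivity.
\<close>

locale local_ring_product = cring R
  for R :: "('r, 'm) ring_scheme" (structure)
    and n :: nat and A :: "nat \<Rightarrow> ('a, 'k) ring_scheme" and p :: "nat \<Rightarrow> 'r \<Rightarrow> 'a" +
  assumes proj_hom: "i < n \<Longrightarrow> ring_hom_ring R (A i) (p i)"
    and joint_surj: "(\<And>i. i < n \<Longrightarrow> x i \<in> carrier (A i)) \<Longrightarrow> \<exists>r\<in>carrier R. \<forall>i<n. p i r = x i"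
    and joint_inj: "r \<in> carrier R \<Longrightarrow> s \<in> carrier R \<Longrightarrow> (\<And>i. i < n \<Longrightarrow> p i r = p i s) \<Longrightarrow> r = s"
    and finite_ideals: "finite {I. ideal I R}"
    and local_factor: "i < n \<Longrightarrow> local_cring (A i)"
    and nonzero_annihilating: "i < n \<Longrightarrow> nonzero_annihilating_ideals (A i) \<noteq> {}"
begin

section \<open>Maximal ideals of the product\<close>

definition M :: "nat \<Rightarrow> 'a set" where
  "M i = (THE I. maximalideal I (A i))"

text \<open>These preimages turn out to be exactly the maximal ideals of \<open>R\<close>, see
  \<open>maximalideals_eq\<close>.\<close>

definition N :: "nat \<Rightarrow> 'r set" where
  "N i = {r \<in> carrier R. p i r \<in> M i}"

lemma ring_factor: "i < n \<Longrightarrow> ring (A i)"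
  using proj_hom ring_hom_ring.axioms(2) by blast

lemma proj_closed: "i < n \<Longrightarrow> r \<in> carrier R \<Longrightarrow> p i r \<in> carrier (A i)"
  by (rule ring_hom_closed[OF ring_hom_ring.homh[OF proj_hom]])

lemma proj_surj:
  assumes "i < n"
  shows "p i ` carrier R = carrier (A i)"
proof
  show "p i ` carrier R \<subseteq> carrier (A i)"
    using proj_closed assms by blast
  show "carrier (A i) \<subseteq> p i ` carrier R"
  proof
    fix a assume "a \<in> carrier (A i)"
    then have "\<exists>r\<in>carrier R. \<forall>j<n. p j r = (if j = i then a else \<zero>\<^bsub>A j\<^esub>)"
      using ring_factor by (intro joint_surj) (auto simp: ring.ring_simprules)
    then show "a \<in> p i ` carrier R"
      using assms by force
  qed
qed

lemma indicator_exists: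
  obtains r where "r \<in> carrier R" "\<And>i. i < n \<Longrightarrow> p i r = (if P i then \<one>\<^bsub>A i\<^esub> else \<zero>\<^bsub>A i\<^esub>)"
proof -
  have "\<exists>r\<in>carrier R. \<forall>i<n. p i r = (if P i then \<one>\<^bsub>A i\<^esub> else \<zero>\<^bsub>A i\<^esub>)"
    using ring_factor by (intro joint_surj) (auto simp: ring.ring_simprules)
  then show thesis
    using that by blast
qed

lemma maximalideal_M:
  assumes "i < n"
  shows "maximalideal (M i) (A i)"
  unfolding M_def using local_cring.unique_maximalideal[OF local_factor[OF assms]] by (rule theI')

lemma maximalideal_factor_unique:
  assumes "i < n" "maximalideal I (A i)"
  shows "I = M i"
  using local_cring.unique_maximalideal[OF local_factor[OF assms(1)]] maximalideal_M[OF assms(1)]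
    assms(2) by blast

lemma ideal_M: "i < n \<Longrightarrow> ideal (M i) (A i)"
  using maximalideal_M maximalideal.axioms(1) by blast

lemma one_notin_M: "i < n \<Longrightarrow> \<one>\<^bsub>A i\<^esub> \<notin> M i"
  using maximalideal_M maximalideal.I_notcarr ideal.one_imp_carrier ideal_M by metis

lemma zero_in_M: "i < n \<Longrightarrow> \<zero>\<^bsub>A i\<^esub> \<in> M i"
  using ideal_M ideal.axioms(1) additive_subgroup.zero_closed by blast

lemma proper_ideal_le_M:
  assumes "i < n" "ideal J (A i)" "J \<noteq> carrier (A i)"
  shows "J \<subseteq> M i"
proof -
  have "finite {I. ideal I (A i)}"
    using ring_hom_ring.finite_ideals_image[OF proj_hom proj_surj finite_ideals] assms(1) by blast
  then show ?thesis
    using ring.proper_ideal_le_maximalideal[OF ring_factor[OF assms(1)] _ assms(2,3)]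
      maximalideal_factor_unique[OF assms(1)] by metis
qed

text \<open>If \<open>M i\<close> were zero, every nonzero ideal of the factor would be the whole
  ring, whose annihilator is zero because it contains the identity. This contradicts the existence
  of a nonzero annihilating ideal.\<close>

lemma M_neq_zero:
  assumes "i < n"
  shows "M i \<noteq> {\<zero>\<^bsub>A i\<^esub>}"
proof
  assume M0: "M i = {\<zero>\<^bsub>A i\<^esub>}"
  interpret Ai: ring "A i"
    using ring_factor assms .
  obtain I where I: "ideal I (A i)" "annihilator (A i) I \<noteq> {\<zero>\<^bsub>A i\<^esub>}" "I \<noteq> {\<zero>\<^bsub>A i\<^esub>}"
    using nonzero_annihilating[OF assms]
    by (auto simp: nonzero_annihilating_ideals_def annihilating_ideals_def)
  have "\<zero>\<^bsub>A i\<^esub> \<in> I"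
    using I(1) ideal.axioms(1) additive_subgroup.zero_closed by blast
  then have "\<not> I \<subseteq> M i"
    using I(3) M0 by blast
  then have "I = carrier (A i)"
    using proper_ideal_le_M assms I(1) by blast
  then have "annihilator (A i) I = {\<zero>\<^bsub>A i\<^esub>}"
    unfolding annihilator_def using Ai.r_one Ai.one_closed by fastforce
  then show False
    using I(2) by simp
qed

lemma ideal_N: "i < n \<Longrightarrow> ideal (N i) R"
  unfolding N_def by (rule ring_hom_ring.ideal_vimage[OF proj_hom ideal_M])

text \<open>The element with coordinate one at \<open>j\<close> and zero elsewhere separates
  \<open>N i\<close> from \<open>N j\<close>.\<close>

lemma N_incomparable:
  assumes "i < n" "j < n" "N i \<subseteq> N j"
  shows "i = j"
proof (rule ccontr)
  assume "i \<noteq> j"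
  obtain r where r: "r \<in> carrier R" "\<And>k. k < n \<Longrightarrow> p k r = (if k = j then \<one>\<^bsub>A k\<^esub> else \<zero>\<^bsub>A k\<^esub>)"
    using indicator_exists[of "\<lambda>k. k = j"] by blast
  have "r \<in> N i" "r \<notin> N j"
    using r assms \<open>i \<noteq> j\<close> zero_in_M one_notin_M by (auto simp: N_def)
  then show False
    using assms by blast
qed

text \<open>\<open>K\<close> projects onto every factor, hence contains each coordinate idempotent,
  and these sum to the identity.\<close>

lemma ideal_eq_carrierI:
  assumes "ideal K R" and not_le: "\<And>i. i < n \<Longrightarrow> \<not> K \<subseteq> N i"
  shows "K = carrier R"
proof -
  interpret K: ideal K R by fact
  have unit: "\<exists>e\<in>K. \<forall>j<n. p j e = (if j = i then \<one>\<^bsub>A j\<^esub> else \<zero>\<^bsub>A j\<^esub>)" if i: "i < n" for i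
  proof -
    interpret h: ring_hom_ring R "A i" "p i"
      using proj_hom i .
    have "\<not> p i ` K \<subseteq> M i"
      using K.Icarr not_le[OF i] by (auto simp: N_def)
    then have "p i ` K = carrier (A i)"
      using proper_ideal_le_M h.ideal_image proj_surj i assms(1) by blast
    then obtain x where x: "x \<in> K" "p i x = \<one>\<^bsub>A i\<^esub>"
      using h.S.one_closed by (metis imageE)
    obtain r where r: "r \<in> carrier R" "\<And>k. k < n \<Longrightarrow> p k r = (if k = i then \<one>\<^bsub>A k\<^esub> else \<zero>\<^bsub>A k\<^esub>)"
      using indicator_exists[of "\<lambda>k. k = i"] by blast
    have "p j (r \<otimes> x) = (if j = i then \<one>\<^bsub>A j\<^esub> else \<zero>\<^bsub>A j\<^esub>)" if "j < n" for j
    proof -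
      interpret hj: ring_hom_ring R "A j" "p j"
        using proj_hom that .
      show ?thesis
        using r x K.Icarr[OF x(1)] that by auto
    qed
    moreover have "r \<otimes> x \<in> K"
      using r x K.I_l_closed by blast
    ultimately show ?thesis
      by blast
  qed
  \<comment> \<open>The witness is the sum of the first \<open>k\<close> coordinate idempotents;
    \<open>k = n\<close> yields the identity.\<close>
  have partial: "\<exists>z\<in>K. \<forall>j<n. p j z = (if j < k then \<one>\<^bsub>A j\<^esub> else \<zero>\<^bsub>A j\<^esub>)" if "k \<le> n" for k
    using that
  proof (induction k)
    case 0
    have "p j \<zero> = \<zero>\<^bsub>A j\<^esub>" if "j < n" for j
    proof -
      interpret hj: ring_hom_ring R "A j" "p j"
        using proj_hom that .
      show ?thesis
        by simp
    qed
    then show ?case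
      using K.zero_closed by (intro bexI[of _ \<zero>]) auto
  next
    case (Suc k)
    then obtain z where z: "z \<in> K" "\<And>j. j < n \<Longrightarrow> p j z = (if j < k then \<one>\<^bsub>A j\<^esub> else \<zero>\<^bsub>A j\<^esub>)"
      by auto
    obtain e where e: "e \<in> K" "\<And>j. j < n \<Longrightarrow> p j e = (if j = k then \<one>\<^bsub>A j\<^esub> else \<zero>\<^bsub>A j\<^esub>)"
      using unit[of k] Suc.prems by auto
    have "p j (z \<oplus> e) = (if j < Suc k then \<one>\<^bsub>A j\<^esub> else \<zero>\<^bsub>A j\<^esub>)" if "j < n" for j
    proof -
      interpret hj: ring_hom_ring R "A j" "p j"
        using proj_hom that .
      show ?thesis
        using z(2)[OF that] e(2)[OF that] K.Icarr[OF z(1)] K.Icarr[OF e(1)] that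
        by (auto simp: ring.ring_simprules ring_factor)
    qed
    then show ?case
      using z(1) e(1) K.a_closed by blast
  qed
  obtain z where z: "z \<in> K" "\<And>j. j < n \<Longrightarrow> p j z = \<one>\<^bsub>A j\<^esub>"
    using partial[of n] by auto
  have "p j \<one> = \<one>\<^bsub>A j\<^esub>" if "j < n" for j
    using ring_hom_one[OF ring_hom_ring.homh[OF proj_hom[OF that]]] .
  then have "z = \<one>"
    using z K.Icarr by (intro joint_inj) auto
  then show ?thesis
    using z(1) K.one_imp_carrier by blast
qed

lemma N_neq_carrier:
  assumes "i < n"
  shows "N i \<noteq> carrier R"
proof -
  have "p i \<one> = \<one>\<^bsub>A i\<^esub>"
    by (rule ring_hom_one[OF ring_hom_ring.homh[OF proj_hom[OF assms]]])
  then have "\<one> \<notin> N i"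
    using one_notin_M[OF assms] by (simp add: N_def)
  then show ?thesis
    by auto
qed

lemma ideal_neq_carrier_iff:
  assumes "ideal K R"
  shows "K \<noteq> carrier R \<longleftrightarrow> (\<exists>i<n. K \<subseteq> N i)"
proof
  assume "K \<noteq> carrier R"
  then show "\<exists>i<n. K \<subseteq> N i"
    using ideal_eq_carrierI[OF assms] by blast
next
  assume "\<exists>i<n. K \<subseteq> N i"
  then obtain i where "i < n" "K \<subseteq> N i"
    by blast
  then show "K \<noteq> carrier R"
    using N_neq_carrier[of i] by (auto simp: N_def)
qed

lemma maximalideal_N:
  assumes "i < n"
  shows "maximalideal (N i) R"
proof (rule maximalidealI)
  show "ideal (N i) R" "carrier R \<noteq> N i"
    using ideal_N N_neq_carrier assms by auto
next
  fix J assume J: "ideal J R" "N i \<subseteq> J"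
  show "J = N i \<or> J = carrier R"
  proof (cases "J = carrier R")
    case False
    then obtain j where "j < n" "J \<subseteq> N j"
      using ideal_neq_carrier_iff J(1) by blast
    then show ?thesis
      using N_incomparable assms J by blast
  qed simp
qed

lemma maximalideals_eq: "{Q. maximalideal Q R} = N ` {..<n}"
proof (intro equalityI subsetI)
  fix Q assume "Q \<in> {Q. maximalideal Q R}"
  then have "maximalideal Q R"
    by simp
  then interpret maximalideal Q R .
  obtain i where i: "i < n" "Q \<subseteq> N i"
    using ideal_neq_carrier_iff[OF is_ideal] I_notcarr by blast
  then have "Q = N i"
    using I_maximal[OF ideal_N[OF i(1)] i(2)] N_neq_carrier[OF i(1)] by (auto simp: N_def)
  then show "Q \<in> N ` {..<n}"
    using i by blast
qed (auto intro: maximalideal_N)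

section \<open>Supports of ideals\<close>

definition supp :: "'r set \<Rightarrow> nat set" where
  "supp I = {i. i < n \<and> I \<subseteq> N i}"

text \<open>An ideal is proper iff it lies in some \<open>N i\<close>, and it lies in the Jacobson
  radical iff it lies in all of them.\<close>

lemma comaximal_vertices_iff:
  "I \<in> comaximal_vertices R \<longleftrightarrow> ideal I R \<and> supp I \<noteq> {} \<and> supp I \<noteq> {..<n}"
proof (cases "ideal I R")
  case True
  then interpret ideal I R .
  have "I \<noteq> carrier R \<longleftrightarrow> supp I \<noteq> {}"
    using ideal_neq_carrier_iff[OF True] by (auto simp: supp_def)
  moreover have "I \<subseteq> jacobson_radical R \<longleftrightarrow> supp I = {..<n}"
    unfolding jacobson_radical_def maximalideals_eq using a_subset by (auto simp: supp_def)
  ultimately show ?thesis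
    using True by (simp add: comaximal_vertices_def)
qed (simp add: comaximal_vertices_def)

text \<open>A sum lies in \<open>N i\<close> iff both summands do, so its support is the
  intersection of theirs, and it is the whole ring iff that is empty.\<close>

lemma sum_eq_carrier_iff:
  assumes "ideal I R" "ideal J R"
  shows "I <+>\<^bsub>R\<^esub> J = carrier R \<longleftrightarrow> supp I \<inter> supp J = {}"
proof -
  interpret I: ideal I R by fact
  interpret J: ideal J R by fact
  have IJ: "ideal (I <+>\<^bsub>R\<^esub> J) R"
    using add_ideals assms .
  have "I <+>\<^bsub>R\<^esub> J \<subseteq> N i \<longleftrightarrow> I \<subseteq> N i \<and> J \<subseteq> N i" if "i < n" for i
  proof
    assume *: "I <+>\<^bsub>R\<^esub> J \<subseteq> N i"
    have "I \<subseteq> I <+>\<^bsub>R\<^esub> J"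
    proof
      fix x assume "x \<in> I"
      then have "x = x \<oplus> \<zero>"
        using I.Icarr by simp
      then show "x \<in> I <+>\<^bsub>R\<^esub> J"
        using \<open>x \<in> I\<close> J.zero_closed unfolding set_add_def' by blast
    qed
    moreover have "J \<subseteq> I <+>\<^bsub>R\<^esub> J"
    proof
      fix x assume "x \<in> J"
      then have "x = \<zero> \<oplus> x"
        using J.Icarr by simp
      then show "x \<in> I <+>\<^bsub>R\<^esub> J"
        using \<open>x \<in> J\<close> I.zero_closed unfolding set_add_def' by blast
    qed
    ultimately show "I \<subseteq> N i \<and> J \<subseteq> N i"
      using * by blast
  next
    assume *: "I \<subseteq> N i \<and> J \<subseteq> N i"
    have "x \<oplus> y \<in> N i" if "x \<in> N i" "y \<in> N i" for x y
      using ideal.axioms(1)[OF ideal_N[OF \<open>i < n\<close>]] that additive_subgroup.a_closed by metis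
    then show "I <+>\<^bsub>R\<^esub> J \<subseteq> N i"
      using * unfolding set_add_def' by blast
  qed
  moreover have "I <+>\<^bsub>R\<^esub> J = carrier R \<longleftrightarrow> (\<forall>i<n. \<not> I <+>\<^bsub>R\<^esub> J \<subseteq> N i)"
    using ideal_neq_carrier_iff[OF IJ] by blast
  ultimately show ?thesis
    by (auto simp: supp_def)
qed

lemma ideal_product:
  assumes "\<And>i. i < n \<Longrightarrow> ideal (I i) (A i)"
  shows "ideal {r \<in> carrier R. \<forall>i<n. p i r \<in> I i} R"
\<comment> \<open>For \<open>n = 0\<close> the intersection below would be the whole type instead of
  the carrier.\<close>
proof (cases "n = 0")
  case True
  then show ?thesis
    using oneideal by simp
next
  case False
  have "{r \<in> carrier R. \<forall>i<n. p i r \<in> I i} = \<Inter>((\<lambda>i. {r \<in> carrier R. p i r \<in> I i}) ` {..<n})"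
    using False by auto
  also have "ideal \<dots> R"
    using False assms ring_hom_ring.ideal_vimage[OF proj_hom] by (intro i_Intersect) auto
  finally show ?thesis .
qed

lemma product_proj:
  assumes "\<And>i. i < n \<Longrightarrow> ideal (I i) (A i)" "j < n"
  shows "p j ` {r \<in> carrier R. \<forall>i<n. p i r \<in> I i} = I j"
proof (intro equalityI subsetI)
  fix a assume a: "a \<in> I j"
  have "\<exists>r\<in>carrier R. \<forall>i<n. p i r = (if i = j then a else \<zero>\<^bsub>A i\<^esub>)"
    using ring_factor a ideal.Icarr[OF assms(1)] by (intro joint_surj) (auto simp: ring.ring_simprules)
  then obtain r where "r \<in> carrier R" "\<And>i. i < n \<Longrightarrow> p i r = (if i = j then a else \<zero>\<^bsub>A i\<^esub>)"
    by blast
  moreover have "\<zero>\<^bsub>A i\<^esub> \<in> I i" if "i < n" for i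
    using assms(1)[OF that] ideal.axioms(1) additive_subgroup.zero_closed by blast
  ultimately show "a \<in> p j ` {r \<in> carrier R. \<forall>i<n. p i r \<in> I i}"
    using a assms(2) by (intro image_eqI[of _ _ r]) auto
qed (use assms(2) in blast)

lemma supp_product:
  assumes "\<And>i. i < n \<Longrightarrow> ideal (I i) (A i)"
  shows "supp {r \<in> carrier R. \<forall>i<n. p i r \<in> I i} = {i. i < n \<and> I i \<subseteq> M i}"
proof -
  let ?P = "{r \<in> carrier R. \<forall>i<n. p i r \<in> I i}"
  have "?P \<subseteq> N j \<longleftrightarrow> I j \<subseteq> M j" if "j < n" for j
  proof -
    have "?P \<subseteq> N j \<longleftrightarrow> p j ` ?P \<subseteq> M j"
      by (auto simp: N_def)
    then show ?thesis
      using product_proj[OF assms that] by simp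
  qed
  then show ?thesis
    by (auto simp: supp_def)
qed

text \<open>Take the whole factor outside \<open>S\<close>, and on \<open>S\<close> either all the
  \<open>M i\<close> or all the zero ideals. The two products differ at any index of
  \<open>S\<close>, as \<open>M j\<close> is nonzero.\<close>

lemma two_ideals_of_supp:
  assumes "S \<subseteq> {..<n}" "S \<noteq> {}"
  shows "\<exists>I J. ideal I R \<and> ideal J R \<and> I \<noteq> J \<and> supp I = S \<and> supp J = S"
proof -
  define P where "P L = {r \<in> carrier R. \<forall>i<n. p i r \<in> (if i \<in> S then L i else carrier (A i))}" for L
  have id: "ideal (if i \<in> S then L i else carrier (A i)) (A i)"
    if "\<And>i. i < n \<Longrightarrow> ideal (L i) (A i)" "i < n" for L i
    using that ring.oneideal[OF ring_factor] by auto
  have supp_P: "supp (P L) = S" if L: "\<And>i. i < n \<Longrightarrow> ideal (L i) (A i)" "\<And>i. i < n \<Longrightarrow> L i \<subseteq> M i" for L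
  proof -
    have "\<not> carrier (A i) \<subseteq> M i" if "i < n" for i
      using one_notin_M[OF that] ring.ring_simprules(6)[OF ring_factor[OF that]] by blast
    then show ?thesis
      using supp_product[OF id[OF L(1)]] L(2) assms(1) unfolding P_def by auto
  qed
  let ?Z = "\<lambda>i. {\<zero>\<^bsub>A i\<^esub>}"
  have Z: "ideal (?Z i) (A i)" if "i < n" for i
    using ring.zeroideal[OF ring_factor[OF that]] .
  obtain j where j: "j \<in> S" "j < n"
    using assms by blast
  have "p j ` P M = M j" "p j ` P ?Z = ?Z j"
    using product_proj[OF id[OF ideal_M] j(2)] product_proj[OF id[OF Z] j(2)] j(1)
    unfolding P_def by auto
  then have "P M \<noteq> P ?Z"
    using M_neq_zero j(2) by metis
  moreover have "ideal (P M) R" "ideal (P ?Z) R"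
    unfolding P_def by (rule ideal_product[OF id[OF ideal_M]] ideal_product[OF id[OF Z]]; assumption)+
  moreover have "supp (P M) = S" "supp (P ?Z) = S"
    using supp_P[OF ideal_M] supp_P[OF Z] zero_in_M by auto
  ultimately show ?thesis
    by blast
qed

end

section \<open>Application to the co-maximal ideal graph of \<open>R\<close>\<close>

theorem theorem3p4:
  fixes R :: "('r, 'm) ring_scheme"
    and Rs :: "('a, 'k) ring_scheme list"
    and n :: nat
  assumes "cring R"
    and "n \<ge> 1"
    and "length Rs = n"
    and "R \<simeq> RDirProd_list Rs"
    and "finite {I. ideal I R}"
    and "\<And>i. i < n \<Longrightarrow> artinian_cring (Rs ! i)"
    and "\<And>i. i < n \<Longrightarrow> local_cring (Rs ! i)"
    and "\<And>i. i < n \<Longrightarrow> nonzero_annihilating_ideals (Rs ! i) \<noteq> {}"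
  shows "int (strong_metric_dim (comaximal_ideal_graph R)) =
           int (card (pverts (comaximal_ideal_graph R))) - 2 * int n + 2"
proof -
  obtain h where h: "h \<in> ring_iso R (RDirProd_list Rs)"
    using assms(4) by (auto simp: is_ring_iso_def)
  then have hom: "h \<in> ring_hom R (RDirProd_list Rs)"
    and bij: "bij_betw h (carrier R) (carrier (RDirProd_list Rs))"
    by (auto simp: ring_iso_def)
  have local_Rs: "local_cring (Rs ! i)" if "i < n" for i
    using assms(7) that .
  interpret P: local_ring_product R n "\<lambda>i. Rs ! i" "\<lambda>i r. h r ! i"
  proof (intro local_ring_product.intro local_ring_product_axioms.intro)
    show "cring R" "finite {I. ideal I R}"
      by (fact assms)+
    show "local_cring (Rs ! i)" "nonzero_annihilating_ideals (Rs ! i) \<noteq> {}" if "i < n" for i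
      using assms(7,8) that by auto
    show "ring_hom_ring R (Rs ! i) (\<lambda>r. h r ! i)" if "i < n" for i
    proof (rule ring_hom_ringI2)
      show "ring R"
        using assms(1) cring.axioms(1) by blast
      show "ring (Rs ! i)"
        using local_Rs[OF that] local_cring.axioms(1) cring.axioms(1) by blast
      show "(\<lambda>r. h r ! i) \<in> ring_hom R (Rs ! i)"
        using ring_hom_trans[OF hom RDirProd_list_nth_hom[of i Rs]] that assms(3)
        by (simp add: comp_def)
    qed
  next
    fix x assume x: "\<And>i. i < n \<Longrightarrow> x i \<in> carrier (Rs ! i)"
    have "map x [0..<n] \<in> carrier (RDirProd_list Rs)"
      using x assms(3) by (intro RDirProd_list_carrier_memI) auto
    then obtain r where "r \<in> carrier R" "h r = map x [0..<n]"
      using bij unfolding bij_betw_def by (metis imageE)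
    then show "\<exists>r\<in>carrier R. \<forall>i<n. h r ! i = x i"
      by (intro bexI[of _ r]) auto
  next
    fix r s assume rs: "r \<in> carrier R" "s \<in> carrier R" "\<And>i. i < n \<Longrightarrow> h r ! i = h s ! i"
    have "length (h r) = n" "length (h s) = n"
      using RDirProd_list_carrier_mem(1) bij_betwE[OF bij] rs(1,2) assms(3) by blast+
    then have "h r = h s"
      using rs(3) by (auto intro: nth_equalityI)
    then show "r = s"
      using bij rs(1,2) by (auto simp: bij_betw_def dest: inj_onD)
  qed
  interpret G: support_graph "comaximal_vertices R" "{..<n}" P.supp
  proof
    show "finite (comaximal_vertices R)"
      by (rule finite_subset[OF _ assms(5)]) (auto simp: comaximal_vertices_def)
    show "P.supp I \<subseteq> {..<n}" for I
      by (auto simp: P.supp_def)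
    show "P.supp I \<noteq> {}" "P.supp I \<noteq> {..<n}" if "I \<in> comaximal_vertices R" for I
      using that by (simp_all add: P.comaximal_vertices_iff)
    show "\<exists>I\<in>comaximal_vertices R. \<exists>J\<in>comaximal_vertices R. I \<noteq> J \<and> P.supp I = S \<and> P.supp J = S"
      if "S \<subseteq> {..<n}" "S \<noteq> {}" "S \<noteq> {..<n}" for S
      using P.two_ideals_of_supp[OF that(1,2)] that P.comaximal_vertices_iff by metis
  qed
  \<comment> \<open>Disjoint supports force \<open>I \<noteq> J\<close>, because supports of
    vertices are nonempty.\<close>
  have "I \<noteq> J \<and> I <+>\<^bsub>R\<^esub> J = carrier R \<longleftrightarrow> P.supp I \<inter> P.supp J = {}"
    if "I \<in> comaximal_vertices R" "J \<in> comaximal_vertices R" for I J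
    using P.sum_eq_carrier_iff[of I J] that by (auto simp: P.comaximal_vertices_iff)
  then have "comaximal_ideal_graph R = G.graph"
    unfolding comaximal_ideal_graph_def G.graph_def by auto
  moreover have "strong_metric_dim G.graph + 2 * card {..<n} = card (comaximal_vertices R) + 2"
    using assms(2) by (intro G.strong_metric_dim_graph) (auto simp: lessThan_empty_iff)
  ultimately show ?thesis
    by simp
qed

end
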